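(* Let $n \geq 1$ and let $f : \mathbb{R}^n \to \mathbb{R}$ be any polynomial of degree two that is non-negative, i.e. $f(x) \geq 0$ for all $x \in \mathbb{R}^n$. Then for every $\varepsilon > 0$, $$\mathbb{P}_{x \sim N(0, I_n)}\left\{ f(x) \leq \varepsilon \cdot \mathbb{E}_{x \sim N(0, I_n)}[f(x)] \right\} \leq (2e \cdot \varepsilon)^{1/2}.$$
   Context: $N(0, I_n)$ denotes the isotropic (standard) Gaussian distribution on $\mathbb{R}^n$, where $I_n$ is the $n \times n$ identity matrix. Degree means total degree of a real polynomial in $n$ variables, and $e$ is Euler's number. *)

theory Defs
  imports "HOL-Probability.Probability" "HOL-Library.Poly_Mapping"
begin

(* A real polynomial in variables indexed by 'n maps each monomial (its finitely supported
   exponent vector) to its coefficient; keys are the monomials with nonzero coefficient. *)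
type_synonym 'n rpoly = "('n \<Rightarrow>\<^sub>0 nat) \<Rightarrow>\<^sub>0 real"

definition rpoly_eval :: "('n::finite) rpoly \<Rightarrow> real ^ 'n \<Rightarrow> real" where
  "rpoly_eval p x =
     (\<Sum>m\<in>Poly_Mapping.keys p. Poly_Mapping.lookup p m * (\<Prod>i\<in>UNIV. (x $ i) ^ Poly_Mapping.lookup m i))"

(* Convention: the zero polynomial has total degree 0. *)
definition rpoly_total_degree :: "('n::finite) rpoly \<Rightarrow> nat" where
  "rpoly_total_degree p =
     Max (insert 0 ((\<lambda>m. \<Sum>i\<in>UNIV. Poly_Mapping.lookup m i) ` Poly_Mapping.keys p))"

definition std_gaussian :: "(real ^ 'n::finite) measure" where
  "std_gaussian =
     density lborel (\<lambda>x. ennreal ((2 * pi) powr (- real CARD('n) / 2) * exp (- (norm x)\<^sup>2 / 2)))"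

lemma space_std_gaussian [simp]: "space std_gaussian = UNIV"
  by (simp add: std_gaussian_def)

lemma sets_std_gaussian [simp, measurable_cong]: "sets std_gaussian = sets borel"
  by (simp add: std_gaussian_def)

lemma std_gaussian_density_eq_prod:
  fixes x :: "real ^ 'n::finite"
  shows "(2 * pi) powr (- real CARD('n) / 2) * exp (- (norm x)\<^sup>2 / 2)
           = (\<Prod>b\<in>Basis. std_normal_density (x \<bullet> b))"
proof -
  have "1 / sqrt (2 * pi) = (2 * pi) powr - (1 / 2)"
    unfolding powr_minus by (subst powr_half_sqrt) (simp_all add: inverse_eq_divide)
  then have "(1 / sqrt (2 * pi)) ^ CARD('n) = ((2 * pi) powr - (1 / 2)) ^ CARD('n)"
    by (rule arg_cong)
  also have "\<dots> = (2 * pi) powr (- (1 / 2) * real CARD('n))"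
    by (subst powr_powr[symmetric], subst powr_realpow) (simp_all only: powr_gt_zero, simp_all)
  also have "- (1 / 2) * real CARD('n) = - real CARD('n) / 2"
    by simp
  finally have c: "(1 / sqrt (2 * pi)) ^ CARD('n) = (2 * pi) powr (- real CARD('n) / 2)" .
  have n: "(norm x)\<^sup>2 = (\<Sum>b\<in>Basis. (x \<bullet> b)\<^sup>2)"
    unfolding power2_norm_eq_inner euclidean_inner[of x x] by (simp only: power2_eq_square)
  have "(\<Prod>b\<in>Basis. std_normal_density (x \<bullet> b))
      = (\<Prod>b\<in>(Basis :: (real ^ 'n) set). 1 / sqrt (2 * pi)) * (\<Prod>b\<in>Basis. exp (- (x \<bullet> b)\<^sup>2 / 2))"
    unfolding std_normal_density_def by (rule prod.distrib)
  also have "(\<Prod>b\<in>(Basis :: (real ^ 'n) set). 1 / sqrt (2 * pi)) = (1 / sqrt (2 * pi)) ^ CARD('n)"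
    by (simp only: prod_constant DIM_cart DIM_real mult_1_right)
  also have "(\<Prod>b\<in>Basis. exp (- (x \<bullet> b)\<^sup>2 / 2)) = exp (- (norm x)\<^sup>2 / 2)"
    by (simp only: exp_sum[OF finite_Basis, symmetric] n sum_negf[symmetric] sum_divide_distrib)
  finally show ?thesis
    by (simp only: c)
qed

lemma prob_space_std_gaussian: "prob_space (std_gaussian :: (real ^ 'n::finite) measure)"
proof
  have "emeasure (std_gaussian :: (real ^ 'n) measure) UNIV
      = (\<integral>\<^sup>+x. ennreal (\<Prod>b\<in>Basis. std_normal_density (x \<bullet> b)) \<partial>(lborel :: (real ^ 'n) measure))"
    unfolding std_gaussian_def std_gaussian_density_eq_prod
    by (subst emeasure_density) auto
  also have "\<dots> = (\<integral>\<^sup>+x. (\<Prod>b\<in>Basis. ennreal (std_normal_density (x \<bullet> b))) \<partial>(lborel :: (real ^ 'n) measure))"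
    by (simp add: prod_ennreal)
  also have "\<dots> = (\<Prod>b\<in>(Basis :: (real ^ 'n) set). \<integral>\<^sup>+x. ennreal (std_normal_density x) \<partial>lborel)"
    by (rule nn_integral_lborel_prod) auto
  also have "(\<integral>\<^sup>+x. ennreal (std_normal_density x) \<partial>lborel) = 1"
    using prob_space.emeasure_space_1[OF prob_space_normal_density[of 1 0]]
    by (simp add: emeasure_density)
  finally show "emeasure (std_gaussian :: (real ^ 'n) measure) (space std_gaussian) = 1"
    by simp
qed

end

theory Submission
  imports Defs
begin

text \<open>
  Write \<open>\<mu> = E f\<close>. The heart of the matter is the Laplace transform bound
  \<open>E (exp (- t f)) \<le> 1 / sqrt (1 + 2 t \<mu>)\<close> for non-negative \<open>f\<close> of degree at most two and \<open>t \<ge> 0\<close>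
  (\<open>nonneg_quadratic_laplace_bound\<close>); equality holds for \<open>f = a y\<^sup>2\<close> in a single variable.
  Markov's inequality for \<open>exp (- t f)\<close> then bounds the probability of \<open>f \<le> \<epsilon> \<mu>\<close> by
  \<open>exp (t \<epsilon> \<mu>) / sqrt (1 + 2 t \<mu>)\<close>, and \<open>t = 1 / (2 \<epsilon> \<mu>)\<close> makes this at most \<open>sqrt (e \<epsilon>)\<close>, which is
  smaller than the claimed \<open>sqrt (2 e \<epsilon>)\<close>.

  The Laplace bound is proved without diagonalising the quadratic form, by integrating out one
  coordinate at a time. Split \<open>f = a y\<^sup>2 + b y + c\<close>, where \<open>y\<close> is one coordinate, \<open>a\<close> is a constant, and
  \<open>b\<close> and \<open>c\<close> are polynomials in the remaining coordinates, of degree one and two. Non-negativity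
  of \<open>f\<close> means \<open>a \<ge> 0\<close>, \<open>c \<ge> 0\<close> and \<open>b\<^sup>2 \<le> 4 a c\<close>. Completing the square, the integral of
  \<open>exp (- t f)\<close> over \<open>y\<close> is \<open>exp (- t g) / sqrt v\<close> with \<open>v = 1 + 2 t a\<close> and \<open>g = c - t b\<^sup>2 / (2 v)\<close>.
  Here \<open>g\<close> is again of degree at most two, and the discriminant condition gives \<open>v g \<ge> c \<ge> 0\<close>
  pointwise. By induction the integral is at most \<open>1 / sqrt (v (1 + 2 t E g))\<close>, and
  \<open>v (1 + 2 t E g) \<ge> v + 2 t E c = 1 + 2 t (a + E c) = 1 + 2 t E f\<close>.

  The choice of \<open>t\<close> needs \<open>\<mu> > 0\<close>. The same splitting shows that a non-negative quadratic with mean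
  zero vanishes identically (\<open>nonneg_quadratic_mean\<close>); since distinct monomials are linearly
  independent as functions (\<open>monomials_linearly_independent\<close>), the polynomial would then be zero and
  could not have degree two.
\<close>

section \<open>Quadratic polynomials in one variable\<close>

lemma nonneg_quadratic_coeffs:
  fixes a b c :: real
  assumes nonneg: "\<And>y. 0 \<le> a * y\<^sup>2 + b * y + c"
  shows "0 \<le> a" and "0 \<le> c" and "b\<^sup>2 \<le> 4 * a * c"
proof -
  show c: "0 \<le> c" using nonneg[of 0] by simp
  show a: "0 \<le> a"
  proof (rule ccontr)
    assume "\<not> 0 \<le> a"
    then have neg: "a < 0" by simp
    (* Adding the values at y and -y cancels the linear term; this y makes a y^2 + c equal to -1. *)
    define y where "y = sqrt ((c + 1) / - a)"
    have "y\<^sup>2 = (c + 1) / - a" unfolding y_def using neg c by (simp add: field_simps)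
    then have "a * y\<^sup>2 = - (c + 1)" using neg by simp
    then show False using nonneg[of y] nonneg[of "- y"] by simp
  qed
  show "b\<^sup>2 \<le> 4 * a * c"
  proof (cases "a = 0")
    case True
    have "b = 0"
    proof (rule ccontr)
      assume "b \<noteq> 0"
      then show False using nonneg[of "- (c + 1) / b"] True by simp
    qed
    then show ?thesis using True by simp
  next
    case False
    then have "0 < a" using a by simp
    (* The vertex of the parabola. *)
    have "a * (- b / (2 * a))\<^sup>2 + b * (- b / (2 * a)) + c = (4 * a * c - b\<^sup>2) / (4 * a)"
      using False by (simp add: field_simps power2_eq_square)
    then have "0 \<le> (4 * a * c - b\<^sup>2) / (4 * a)" using nonneg[of "- b / (2 * a)"] by simp
    then show ?thesis using \<open>0 < a\<close> by (simp add: zero_le_divide_iff)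
  qed
qed

lemma nn_integral_std_normal_quadratic:
  fixes a b c :: real
  assumes nonneg: "\<And>y. 0 \<le> a * y\<^sup>2 + b * y + c"
  shows "(\<integral>\<^sup>+ y. ennreal (a * y\<^sup>2 + b * y + c) \<partial>std_normal_distribution) = ennreal (a + c)"
proof -
  have m0: "has_bochner_integral lborel std_normal_density 1"
    using std_normal_moment_even[of 0] by simp
  have m1: "has_bochner_integral lborel (\<lambda>y. std_normal_density y * y) 0"
    using std_normal_moment_odd[of 0] by simp
  have m2: "has_bochner_integral lborel (\<lambda>y. std_normal_density y * y\<^sup>2) 1"
    using std_normal_moment_even[of 1] by (simp add: fact_numeral)
  have "has_bochner_integral lborel (\<lambda>y. (std_normal_density y * y\<^sup>2) * a
          + (std_normal_density y * y) * b + std_normal_density y * c) (1 * a + 0 * b + 1 * c)"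
    by (intro has_bochner_integral_add has_bochner_integral_mult_left m0 m1 m2)
  moreover have "(\<lambda>y. (std_normal_density y * y\<^sup>2) * a
          + (std_normal_density y * y) * b + std_normal_density y * c)
        = (\<lambda>y. std_normal_density y * (a * y\<^sup>2 + b * y + c))"
    by (simp add: fun_eq_iff algebra_simps)
  ultimately have "has_bochner_integral lborel
      (\<lambda>y. std_normal_density y * (a * y\<^sup>2 + b * y + c)) (a + c)"
    by simp
  then have "(\<integral>\<^sup>+ y. ennreal (std_normal_density y * (a * y\<^sup>2 + b * y + c)) \<partial>lborel) = ennreal (a + c)"
    using nonneg by (subst nn_integral_eq_integral) (auto simp: has_bochner_integral_iff)
  then show ?thesis
    using nonneg by (subst nn_integral_density) (auto simp: ennreal_mult)
qed

text \<open>Completing the square: the integrand is a constant multiple of the density of the normal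
  distribution with mean \<open>- t b / v\<close> and variance \<open>1 / v\<close>, where \<open>v = 1 + 2 t a\<close>.\<close>
lemma nn_integral_std_normal_exp_quadratic:
  fixes a b c t :: real
  assumes at: "0 < 1 + 2 * t * a"
  shows "(\<integral>\<^sup>+ y. ennreal (exp (- t * (a * y\<^sup>2 + b * y + c))) \<partial>std_normal_distribution)
       = ennreal (1 / sqrt (1 + 2 * t * a) * exp (- t * (c - t * b\<^sup>2 / (2 * (1 + 2 * t * a)))))"
    (is "_ = ennreal ?K")
proof -
  define v where "v = 1 + 2 * t * a"
  have v: "0 < v" using at by (simp add: v_def)
  define \<sigma> where "\<sigma> = 1 / sqrt v"
  define \<mu> where "\<mu> = - t * b / v"
  have \<sigma>: "0 < \<sigma>" using v by (simp add: \<sigma>_def)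
  have \<sigma>2: "\<sigma>\<^sup>2 = 1 / v" using v by (simp add: \<sigma>_def power_divide)
  have pt: "std_normal_density y * exp (- t * (a * y\<^sup>2 + b * y + c)) = ?K * normal_density \<mu> \<sigma> y" for y
  proof -
    have e: "- (y\<^sup>2) / 2 + - t * (a * y\<^sup>2 + b * y + c)
        = - t * (c - t * b\<^sup>2 / (2 * v)) + - (y - \<mu>)\<^sup>2 / (2 * \<sigma>\<^sup>2)"
    proof -
      have "- (y - \<mu>)\<^sup>2 / (2 * \<sigma>\<^sup>2) = - (v * y\<^sup>2 + 2 * t * b * y + t * (t * b\<^sup>2) / v) / 2"
        unfolding \<sigma>2 \<mu>_def using v by (simp add: field_simps power2_eq_square)
      moreover have "v * y\<^sup>2 = y\<^sup>2 + 2 * t * a * y\<^sup>2" by (simp add: v_def algebra_simps)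
      ultimately show ?thesis by (simp add: algebra_simps add_divide_distrib diff_divide_distrib)
    qed
    have s: "sqrt (2 * pi * \<sigma>\<^sup>2) = sqrt (2 * pi) / sqrt v"
      using v by (simp add: \<sigma>2 real_sqrt_mult real_sqrt_divide)
    have "std_normal_density y * exp (- t * (a * y\<^sup>2 + b * y + c))
        = 1 / sqrt (2 * pi) * exp (- (y\<^sup>2) / 2 + - t * (a * y\<^sup>2 + b * y + c))"
      by (simp only: std_normal_density_def exp_add mult.assoc)
    also have "\<dots> = 1 / sqrt (2 * pi) * (exp (- t * (c - t * b\<^sup>2 / (2 * v))) * exp (- (y - \<mu>)\<^sup>2 / (2 * \<sigma>\<^sup>2)))"
      by (simp only: e exp_add)
    also have "\<dots> = ?K * normal_density \<mu> \<sigma> y"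
      unfolding normal_density_def s v_def[symmetric] using v by (simp add: field_simps)
    finally show ?thesis .
  qed
  have K: "0 \<le> ?K" using v by (simp add: v_def)
  have "(\<integral>\<^sup>+ y. ennreal (exp (- t * (a * y\<^sup>2 + b * y + c))) \<partial>std_normal_distribution)
      = (\<integral>\<^sup>+ y. ennreal (std_normal_density y * exp (- t * (a * y\<^sup>2 + b * y + c))) \<partial>lborel)"
    by (subst nn_integral_density) (auto simp: ennreal_mult)
  also have "\<dots> = (\<integral>\<^sup>+ y. ennreal ?K * ennreal (normal_density \<mu> \<sigma> y) \<partial>lborel)"
    unfolding pt using K by (simp only: ennreal_mult normal_density_nonneg)
  also have "\<dots> = ennreal ?K * (\<integral>\<^sup>+ y. ennreal (normal_density \<mu> \<sigma> y) \<partial>lborel)"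
    by (rule nn_integral_cmult) simp
  also have "(\<integral>\<^sup>+ y. ennreal (normal_density \<mu> \<sigma> y) \<partial>lborel) = 1"
    using prob_space.emeasure_space_1[OF prob_space_normal_density[OF \<sigma>, of \<mu>]]
    by (simp add: emeasure_density)
  finally show ?thesis by simp
qed

section \<open>Polynomial functions of finitely many real coordinates\<close>

text \<open>The functions given by polynomials of total degree at most \<open>d\<close> in the coordinates from \<open>I\<close>. As
  functions of all of \<open>'i \<Rightarrow> real\<close> they can be restricted to fewer coordinates without a change of
  type, which is what an induction on the number of coordinates requires.\<close>
inductive poly_on :: "'i set \<Rightarrow> nat \<Rightarrow> (('i \<Rightarrow> real) \<Rightarrow> real) \<Rightarrow> bool" for I :: "'i set" where
  const: "poly_on I d (\<lambda>_. c)"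
| add: "poly_on I d f \<Longrightarrow> poly_on I d g \<Longrightarrow> poly_on I d (\<lambda>x. f x + g x)"
| mult_var: "i \<in> I \<Longrightarrow> poly_on I d f \<Longrightarrow> poly_on I (Suc d) (\<lambda>x. x i * f x)"

lemma poly_on_mono: "poly_on I d f \<Longrightarrow> d \<le> e \<Longrightarrow> poly_on I e f"
proof (induction arbitrary: e rule: poly_on.induct)
  case (mult_var i d f)
  then show ?case by (cases e) (auto intro: poly_on.mult_var)
qed (auto intro: poly_on.intros)

lemma poly_on_scale: "poly_on I d f \<Longrightarrow> poly_on I d (\<lambda>x. c * f x)"
proof (induction rule: poly_on.induct)
  case (add d f g)
  then show ?case by (simp add: distrib_left poly_on.add)
next
  case (mult_var i d f)
  then show ?case using poly_on.mult_var[of i I d "\<lambda>x. c * f x"] by (simp add: mult.left_commute)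
qed (rule poly_on.const)

lemma poly_on_mult: "poly_on I d f \<Longrightarrow> poly_on I e g \<Longrightarrow> poly_on I (d + e) (\<lambda>x. f x * g x)"
proof (induction rule: poly_on.induct)
  case (const d c)
  then show ?case by (intro poly_on_mono[OF poly_on_scale]) auto
next
  case (add d f h)
  then show ?case by (simp add: distrib_right poly_on.add)
next
  case (mult_var i d f)
  then show ?case using poly_on.mult_var[of i I "d + e" "\<lambda>x. f x * g x"] by (simp add: mult.assoc)
qed

lemma poly_on_sum:
  assumes "finite S" and "\<And>s. s \<in> S \<Longrightarrow> poly_on I d (f s)"
  shows "poly_on I d (\<lambda>x. \<Sum>s\<in>S. f s x)"
  using assms by (induction S rule: finite_induct) (auto intro: poly_on.intros)

lemma poly_on_var_power: "i \<in> I \<Longrightarrow> poly_on I n (\<lambda>x. x i ^ n)"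
  by (induction n) (auto intro: poly_on.intros)

lemma poly_on_monomial:
  assumes "finite J" and "\<And>j. j \<in> J \<Longrightarrow> \<phi> j \<in> I"
  shows "poly_on I (\<Sum>j\<in>J. m j) (\<lambda>x. \<Prod>j\<in>J. x (\<phi> j) ^ m j)"
  using assms
proof (induction J rule: finite_induct)
  case (insert j J)
  then show ?case by (auto intro!: poly_on_mult poly_on_var_power)
qed (auto intro: poly_on.const)

abbreviation iid_std_normal :: "'i set \<Rightarrow> ('i \<Rightarrow> real) measure" where
  "iid_std_normal I \<equiv> PiM I (\<lambda>_. std_normal_distribution)"

lemma poly_on_measurable:
  assumes "poly_on I d f"
  shows "f \<in> borel_measurable (iid_std_normal I)"
  using assms
proof (induction rule: poly_on.induct)
  case (mult_var i d f)
  have "(\<lambda>x. x i) \<in> measurable (iid_std_normal I) std_normal_distribution"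
    using \<open>i \<in> I\<close> by (rule measurable_component_singleton)
  then show ?case using mult_var by (auto intro: borel_measurable_times)
qed auto

lemma poly_on_0_const: "poly_on I d f \<Longrightarrow> d = 0 \<Longrightarrow> \<exists>c. f = (\<lambda>_. c)"
  by (induction rule: poly_on.induct) auto

lemma poly_on_empty_const: "poly_on {} d f \<Longrightarrow> \<exists>c. f = (\<lambda>_. c)"
  by (induction rule: poly_on.induct) auto

text \<open>Splitting off the coordinate \<open>k\<close> as \<open>y\<close>, a polynomial becomes a polynomial in \<open>y\<close> whose
  coefficients no longer involve \<open>k\<close> and lose one degree for each power of \<open>y\<close>. In degree two this
  makes the leading coefficient a constant, so that integrating over \<open>y\<close> stays within polynomials.\<close>
lemma poly_on_insert_expand:
  assumes "poly_on (insert k I) d f"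
  shows "\<exists>g. (\<forall>j\<le>d. poly_on I (d - j) (g j)) \<and> (\<forall>x y. f (x(k := y)) = (\<Sum>j\<le>d. g j x * y ^ j))"
  using assms
proof (induction rule: poly_on.induct)
  case (const d c)
  have "(\<Sum>j\<le>d. (if j = 0 then c else 0) * y ^ j) = c" for y :: real
    by (simp add: if_distrib[of "\<lambda>u. u * _"] cong: if_cong)
  then show ?case
    by (intro exI[of _ "\<lambda>j _. if j = 0 then c else 0"]) (auto intro: poly_on.const)
next
  case (add d f1 f2)
  then obtain g1 g2 where
    "\<forall>j\<le>d. poly_on I (d - j) (g1 j)" "\<forall>x y. f1 (x(k := y)) = (\<Sum>j\<le>d. g1 j x * y ^ j)"
    "\<forall>j\<le>d. poly_on I (d - j) (g2 j)" "\<forall>x y. f2 (x(k := y)) = (\<Sum>j\<le>d. g2 j x * y ^ j)"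
    by blast
  then show ?case
    by (intro exI[of _ "\<lambda>j x. g1 j x + g2 j x"])
       (auto intro: poly_on.add simp: distrib_right sum.distrib simp del: fun_upd_apply)
next
  case (mult_var i d f)
  then obtain g where g: "\<forall>j\<le>d. poly_on I (d - j) (g j)"
    and f: "\<forall>x y. f (x(k := y)) = (\<Sum>j\<le>d. g j x * y ^ j)" by blast
  show ?case
  proof (cases "i = k")
    case True
    have "poly_on I (Suc d - j) (case j of 0 \<Rightarrow> \<lambda>_. 0 | Suc j' \<Rightarrow> g j')" if "j \<le> Suc d" for j
      using that g by (cases j) (auto intro: poly_on.const)
    moreover have "y * (\<Sum>j\<le>d. g j x * y ^ j)
        = (\<Sum>j\<le>Suc d. (case j of 0 \<Rightarrow> \<lambda>_. 0 | Suc j' \<Rightarrow> g j') x * y ^ j)" for x y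
      by (subst sum.atMost_Suc_shift) (simp add: sum_distrib_left mult.left_commute)
    then have "(x(k := y)) i * f (x(k := y))
        = (\<Sum>j\<le>Suc d. (case j of 0 \<Rightarrow> \<lambda>_. 0 | Suc j' \<Rightarrow> g j') x * y ^ j)" for x y
      by (simp only: True f[rule_format] fun_upd_same)
    ultimately show ?thesis
      by (intro exI[of _ "\<lambda>j. case j of 0 \<Rightarrow> \<lambda>_. 0 | Suc j' \<Rightarrow> g j'"] conjI allI impI)
  next
    case False
    then have i: "i \<in> I" using mult_var by auto
    have "poly_on I (Suc d - j) (\<lambda>x. if j \<le> d then x i * g j x else 0)" if "j \<le> Suc d" for j
      using that g i by (cases "j \<le> d") (auto simp: Suc_diff_le intro: poly_on.intros)
    moreover have "x i * (\<Sum>j\<le>d. g j x * y ^ j)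
        = (\<Sum>j\<le>Suc d. (if j \<le> d then x i * g j x else 0) * y ^ j)" for x y
      by (simp add: sum_distrib_left mult.assoc)
    then have "(x(k := y)) i * f (x(k := y))
        = (\<Sum>j\<le>Suc d. (if j \<le> d then x i * g j x else 0) * y ^ j)" for x y
      by (simp only: fun_upd_other[OF False] f[rule_format])
    ultimately show ?thesis
      by (intro exI[of _ "\<lambda>j x. if j \<le> d then x i * g j x else 0"] conjI allI impI)
  qed
qed

lemma nonneg_quadratic_section:
  fixes f :: "('i \<Rightarrow> real) \<Rightarrow> real"
  assumes f: "poly_on (insert k I) 2 f" and nonneg: "\<And>x. 0 \<le> f x"
  obtains a b c where
    "poly_on I 1 b" "poly_on I 2 c" "\<forall>x y. f (x(k := y)) = a * y\<^sup>2 + b x * y + c x"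
    "0 \<le> a" "\<forall>x. 0 \<le> c x" "\<forall>x. (b x)\<^sup>2 \<le> 4 * a * c x"
proof -
  obtain g where g: "\<forall>j\<le>2. poly_on I (2 - j) (g j)"
    and fg: "\<And>x y. f (x(k := y)) = (\<Sum>j\<le>2. g j x * y ^ j)"
    using poly_on_insert_expand[OF f] by blast
  have "poly_on I (2 - 2) (g 2)" using g by blast
  then obtain a where a: "g 2 = (\<lambda>_. a)" using poly_on_0_const[of I 0 "g 2"] by auto
  have eq: "f (x(k := y)) = a * y\<^sup>2 + g 1 x * y + g 0 x" for x y
    using fg[of x y] a by (simp add: numeral_2_eq_2)
  have "0 \<le> a * y\<^sup>2 + g 1 x * y + g 0 x" for x y using nonneg[of "x(k := y)"] eq by simp
  note coeffs = nonneg_quadratic_coeffs[OF this]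
  show thesis
  proof (rule that)
    show "\<forall>x y. f (x(k := y)) = a * y\<^sup>2 + g 1 x * y + g 0 x" using eq by blast
    show "0 \<le> a" by (rule coeffs(1))
    show "\<forall>x. 0 \<le> g 0 x" "\<forall>x. (g 1 x)\<^sup>2 \<le> 4 * a * g 0 x" using coeffs(2,3) by blast+
    show "poly_on I 1 (g 1)" using g[rule_format, of 1] by simp
    show "poly_on I 2 (g 0)" using g[rule_format, of 0] by simp
  qed
qed

text \<open>Group the monomials by their exponent \<open>j\<close> of the coordinate \<open>k\<close>. For fixed values of the others
  this is a polynomial in one real variable that vanishes everywhere, hence each group vanishes,
  and within a group the monomials are told apart by the remaining coordinates. The monomials
  form an abstract index set, so that they can be restricted to fewer coordinates.\<close>
lemma monomials_linearly_independent:
  fixes c :: "'m \<Rightarrow> real" and e :: "'m \<Rightarrow> 'i \<Rightarrow> nat"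
  assumes "finite I" and "finite S"
    and "\<And>m m'. m \<in> S \<Longrightarrow> m' \<in> S \<Longrightarrow> (\<And>i. i \<in> I \<Longrightarrow> e m i = e m' i) \<Longrightarrow> m = m'"
    and "\<And>x. (\<Sum>m\<in>S. c m * (\<Prod>i\<in>I. x i ^ e m i)) = 0"
    and "m \<in> S"
  shows "c m = 0"
  using assms
proof (induction I arbitrary: S m rule: finite_induct)
  case empty
  then have "S = {m}" by auto
  then show ?case using empty(3) by simp
next
  case (insert k I)
  define n where "n = Max ((\<lambda>m. e m k) ` S)"
  have le: "e m' k \<in> {..n}" if "m' \<in> S" for m' using that insert.prems(1) by (auto simp: n_def)
  define G where "G x j = (\<Sum>m | m \<in> S \<and> e m k = j. c m * (\<Prod>i\<in>I. x i ^ e m i))" for x :: "'i \<Rightarrow> real" and j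
  have "(\<Sum>j\<le>n. G x j * y ^ j) = 0" for x y
  proof -
    have "(\<Prod>i\<in>insert k I. (x(k := y)) i ^ e m' i) = (\<Prod>i\<in>I. x i ^ e m' i) * y ^ e m' k" for m'
    proof -
      have "(\<Prod>i\<in>I. (x(k := y)) i ^ e m' i) = (\<Prod>i\<in>I. x i ^ e m' i)"
        using insert.hyps by (intro prod.cong) auto
      then show ?thesis using insert.hyps by (simp add: mult.commute)
    qed
    then have "0 = (\<Sum>m\<in>S. c m * (\<Prod>i\<in>I. x i ^ e m i) * y ^ e m k)"
      using insert.prems(3)[of "x(k := y)"] by (simp add: mult.assoc)
    also have "\<dots> = (\<Sum>j\<le>n. \<Sum>m | m \<in> S \<and> e m k = j. c m * (\<Prod>i\<in>I. x i ^ e m i) * y ^ e m k)"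
      using insert.prems(1) le by (subst sum.group) auto
    also have "\<dots> = (\<Sum>j\<le>n. G x j * y ^ j)"
      unfolding G_def sum_distrib_right by (intro sum.cong) auto
    finally show ?thesis by simp
  qed
  then have "G x j = 0" if "j \<le> n" for x j
    using polyfun_eq_0[of "G x" n] that by blast
  then have "(\<Sum>m' | m' \<in> S \<and> e m' k = e m k. c m' * (\<Prod>i\<in>I. x i ^ e m' i)) = 0" for x
    using le[OF insert.prems(4)] unfolding G_def by simp
  moreover have "m1 = m2" if "m1 \<in> {m' \<in> S. e m' k = e m k}" "m2 \<in> {m' \<in> S. e m' k = e m k}"
    "\<And>i. i \<in> I \<Longrightarrow> e m1 i = e m2 i" for m1 m2
    using that by (intro insert.prems(2)) auto
  ultimately show ?case
    using insert.prems(1,4) by (intro insert.IH[of "{m' \<in> S. e m' k = e m k}"]) auto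
qed

section \<open>Mean and Laplace transform under a product of standard normal distributions\<close>

interpretation std_normals: product_sigma_finite "\<lambda>_. std_normal_distribution"
proof -
  interpret prob_space std_normal_distribution by (rule prob_space_normal_density) simp
  show "product_sigma_finite (\<lambda>_. std_normal_distribution)" by standard
qed

lemma nn_integral_poly_insert:
  assumes "finite I" "k \<notin> I" and f: "poly_on (insert k I) 2 f"
    and c: "poly_on I 2 c" and eq: "\<And>x y. f (x(k := y)) = a * y\<^sup>2 + b x * y + c x"
    and nonneg: "\<And>x. 0 \<le> f x"
    and a: "0 \<le> a" and c0: "\<And>x. 0 \<le> c x"
  shows "(\<integral>\<^sup>+ x. ennreal (f x) \<partial>iid_std_normal (insert k I))
       = ennreal a + (\<integral>\<^sup>+ x. ennreal (c x) \<partial>iid_std_normal I)"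
proof -
  interpret P: prob_space "iid_std_normal I"
    by (intro prob_space_PiM prob_space_normal_density) simp
  have [measurable]: "f \<in> borel_measurable (iid_std_normal (insert k I))"
    "c \<in> borel_measurable (iid_std_normal I)"
    using f c by (auto intro: poly_on_measurable)
  have inner: "(\<integral>\<^sup>+ y. ennreal (f (x(k := y))) \<partial>std_normal_distribution) = ennreal (a + c x)" for x
    using nonneg[of "x(k := _)"] unfolding eq by (rule nn_integral_std_normal_quadratic)
  have "(\<integral>\<^sup>+ x. ennreal (f x) \<partial>iid_std_normal (insert k I))
      = (\<integral>\<^sup>+ x. ennreal (a + c x) \<partial>iid_std_normal I)"
    using assms(1,2) by (subst std_normals.product_nn_integral_insert) (simp_all add: inner)
  also have "\<dots> = (\<integral>\<^sup>+ x. ennreal a + ennreal (c x) \<partial>iid_std_normal I)"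
    using a c0 by (simp add: ennreal_plus)
  also have "\<dots> = ennreal a + (\<integral>\<^sup>+ x. ennreal (c x) \<partial>iid_std_normal I)"
    by (subst nn_integral_add) (auto simp: P.emeasure_space_1)
  finally show ?thesis .
qed

text \<open>The mean is finite because each coordinate adds its constant leading coefficient \<open>a\<close>. If the mean
  is zero, then \<open>a = 0\<close> and, inductively, \<open>c = 0\<close>, whence \<open>b = 0\<close> by the discriminant condition.
  This yields vanishing everywhere rather than almost everywhere without an appeal to continuity.\<close>
lemma nonneg_quadratic_mean:
  assumes "finite I" and "poly_on I 2 f" and "\<And>x. 0 \<le> f x"
  obtains m where "0 \<le> m"
    and "(\<integral>\<^sup>+ x. ennreal (f x) \<partial>iid_std_normal I) = ennreal m"
    and "m = 0 \<longrightarrow> (\<forall>x. f x = 0)"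
proof -
  have "\<exists>m\<ge>0. (\<integral>\<^sup>+ x. ennreal (f x) \<partial>iid_std_normal I) = ennreal m
          \<and> (m = 0 \<longrightarrow> (\<forall>x. f x = 0))"
    using assms
  proof (induction I arbitrary: f rule: finite_induct)
    case empty
    obtain c where "f = (\<lambda>_. c)" using poly_on_empty_const[OF empty.prems(1)] by blast
    then show ?case using empty.prems(2)
      by (intro exI[of _ c]) (auto simp: PiM_empty)
  next
    case (insert k I)
    obtain a b c where "poly_on I 1 b" "poly_on I 2 c"
      "\<forall>x y. f (x(k := y)) = a * y\<^sup>2 + b x * y + c x"
      "0 \<le> a" "\<forall>x. 0 \<le> c x" "\<forall>x. (b x)\<^sup>2 \<le> 4 * a * c x"
      by (rule nonneg_quadratic_section[OF insert.prems])
    note abc = this[rule_format]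
    obtain m where m: "0 \<le> m"
      "(\<integral>\<^sup>+ x. ennreal (c x) \<partial>iid_std_normal I) = ennreal m"
      "m = 0 \<longrightarrow> (\<forall>x. c x = 0)"
      using insert.IH[OF abc(2,5)] by blast
    have "f x = 0" if "a + m = 0" for x
    proof -
      have "a = 0" "m = 0" using that abc(4) m(1) by auto
      then show ?thesis using abc(3)[of x "x k"] abc(6)[of x] m(3) by simp
    qed
    then show ?case
      using nn_integral_poly_insert[OF insert.hyps insert.prems(1) abc(2,3) insert.prems(2) abc(4,5)]
        m(1,2) abc(4)
      by (intro exI[of _ "a + m"]) (simp add: ennreal_plus)
  qed
  then show thesis using that by blast
qed

text \<open>Integrating out the coordinate \<open>k\<close> replaces \<open>f = a y\<^sup>2 + b y + c\<close> by \<open>g = c - t b\<^sup>2 / (2 v)\<close> at the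
  cost of a factor \<open>1 / sqrt v\<close>. The means then combine as required because \<open>c \<le> v g\<close>.\<close>
lemma nonneg_quadratic_laplace_bound:
  assumes "finite I" and "poly_on I 2 f" and "\<And>x. 0 \<le> f x"
    and "0 \<le> t" and "0 \<le> m"
    and "(\<integral>\<^sup>+ x. ennreal (f x) \<partial>iid_std_normal I) = ennreal m"
  shows "(\<integral>\<^sup>+ x. ennreal (exp (- t * f x)) \<partial>iid_std_normal I)
       \<le> ennreal (1 / sqrt (1 + 2 * t * m))"
  using assms
proof (induction I arbitrary: f m rule: finite_induct)
  case empty
  obtain c where f: "f = (\<lambda>_. c)" using poly_on_empty_const[OF empty.prems(1)] by blast
  then have c: "c = m" using empty.prems(2,4,5) by (simp add: PiM_empty)
  have "sqrt (1 + 2 * t * m) \<le> sqrt (exp (2 * t * m))"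
    by (simp add: exp_ge_add_one_self)
  also have "exp (2 * t * m) = (exp (t * m))\<^sup>2" by (simp add: exp_double[symmetric] mult.assoc)
  also have "sqrt ((exp (t * m))\<^sup>2) = exp (t * m)" by simp
  finally have "exp (- t * m) \<le> 1 / sqrt (1 + 2 * t * m)"
    using empty.prems(3,4) by (simp add: exp_minus field_simps add_pos_nonneg)
  then show ?case by (simp add: f c PiM_empty ennreal_leI)
next
  case (insert k I)
  note t = \<open>0 \<le> t\<close>
  obtain a b c where "poly_on I 1 b" "poly_on I 2 c"
    "\<forall>x y. f (x(k := y)) = a * y\<^sup>2 + b x * y + c x"
    "0 \<le> a" "\<forall>x. 0 \<le> c x" "\<forall>x. (b x)\<^sup>2 \<le> 4 * a * c x"
    by (rule nonneg_quadratic_section[OF insert.prems(1,2)])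
  note abc = this[rule_format]
  define v where "v = 1 + 2 * t * a"
  have v: "1 \<le> v" using t abc(4) by (simp add: v_def)
  define g where "g x = c x - t * (b x)\<^sup>2 / (2 * v)" for x
  have g_poly: "poly_on I 2 g"
  proof -
    have "poly_on I (1 + 1) (\<lambda>x. b x * b x)" using abc(1) by (intro poly_on_mult)
    then have "poly_on I 2 (\<lambda>x. c x + (- t / (2 * v)) * (b x * b x))"
      using abc(2) by (intro poly_on.add poly_on_scale) (simp_all add: numeral_2_eq_2)
    moreover have "g = (\<lambda>x. c x + (- t / (2 * v)) * (b x * b x))"
      by (simp add: g_def fun_eq_iff power2_eq_square)
    ultimately show ?thesis by simp
  qed
  (* This is where the discriminant condition enters: t b^2 / 2 is at most 2 t a c = (v - 1) c. *)
  have c_le: "c x \<le> v * g x" for x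
  proof -
    have "v * g x = v * c x - t * (b x)\<^sup>2 / 2" using v by (simp add: g_def field_simps)
    moreover have "t * (b x)\<^sup>2 \<le> t * (4 * a * c x)" using abc(6) t by (rule mult_left_mono)
    ultimately show ?thesis by (simp add: v_def algebra_simps)
  qed
  have g_nonneg: "0 \<le> g x" for x
    using c_le[of x] abc(5)[of x] v by (smt (verit) mult_pos_neg)
  obtain mc where mc: "0 \<le> mc"
    "(\<integral>\<^sup>+ x. ennreal (c x) \<partial>iid_std_normal I) = ennreal mc" "mc = 0 \<longrightarrow> (\<forall>x. c x = 0)"
    by (rule nonneg_quadratic_mean[OF insert.hyps(1) abc(2,5)])
  obtain mg where mg: "0 \<le> mg"
    "(\<integral>\<^sup>+ x. ennreal (g x) \<partial>iid_std_normal I) = ennreal mg" "mg = 0 \<longrightarrow> (\<forall>x. g x = 0)"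
    by (rule nonneg_quadratic_mean[OF insert.hyps(1) g_poly g_nonneg])
  have [measurable]: "f \<in> borel_measurable (iid_std_normal (insert k I))"
    "g \<in> borel_measurable (iid_std_normal I)"
    using insert.prems(1) g_poly by (auto intro: poly_on_measurable)
  have "ennreal m = ennreal a + ennreal mc"
    unfolding insert.prems(5)[symmetric] mc(2)[symmetric]
    by (rule nn_integral_poly_insert[OF insert.hyps(1,2) insert.prems(1) abc(2,3) insert.prems(2) abc(4,5)])
  also have "\<dots> = ennreal (a + mc)" by (rule ennreal_plus[symmetric, OF abc(4) mc(1)])
  finally have m: "m = a + mc"
    by (rule ennreal_inj[THEN iffD1, OF insert.prems(4) add_nonneg_nonneg[OF abc(4) mc(1)]])
  have "ennreal mc \<le> (\<integral>\<^sup>+ x. ennreal v * ennreal (g x) \<partial>iid_std_normal I)"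
    unfolding mc(2)[symmetric] using v g_nonneg c_le
    by (intro nn_integral_mono) (simp add: ennreal_mult[symmetric] ennreal_leI)
  also have "\<dots> = ennreal (v * mg)"
    using v mg(1,2) by (subst nn_integral_cmult) (auto simp: ennreal_mult)
  finally have "mc \<le> v * mg" using v mg(1) by simp
  then have "t * mc \<le> t * (v * mg)" using t by (rule mult_left_mono)
  then have m_le: "1 + 2 * t * m \<le> v * (1 + 2 * t * mg)"
    by (simp add: m v_def algebra_simps)
  have inner: "(\<integral>\<^sup>+ y. ennreal (exp (- t * f (x(k := y)))) \<partial>std_normal_distribution)
      = ennreal (1 / sqrt v * exp (- t * g x))" for x
    unfolding abc(3) g_def v_def
    by (rule nn_integral_std_normal_exp_quadratic) (use v in \<open>unfold v_def, linarith\<close>)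
  have "(\<integral>\<^sup>+ x. ennreal (exp (- t * f x)) \<partial>iid_std_normal (insert k I))
      = (\<integral>\<^sup>+ x. ennreal (1 / sqrt v * exp (- t * g x)) \<partial>iid_std_normal I)"
    using insert.hyps by (subst std_normals.product_nn_integral_insert) (simp_all only: inner, simp_all)
  also have "\<dots> = ennreal (1 / sqrt v) * (\<integral>\<^sup>+ x. ennreal (exp (- t * g x)) \<partial>iid_std_normal I)"
    using v by (subst nn_integral_cmult[symmetric]) (auto simp: ennreal_mult[symmetric])
  also have "\<dots> \<le> ennreal (1 / sqrt v) * ennreal (1 / sqrt (1 + 2 * t * mg))"
    using insert.IH[OF g_poly g_nonneg t mg(1,2)] by (rule mult_left_mono) simp
  also have "\<dots> = ennreal (1 / sqrt (v * (1 + 2 * t * mg)))"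
    using v t mg(1) by (subst ennreal_mult[symmetric]) (simp_all add: real_sqrt_mult)
  also have "\<dots> \<le> ennreal (1 / sqrt (1 + 2 * t * m))"
    using m_le t insert.prems(4) by (intro ennreal_leI divide_left_mono mult_pos_pos)
      (auto simp: add_pos_nonneg intro: less_le_trans[OF _ m_le])
  finally show ?case .
qed

section \<open>The standard Gaussian measure as a product measure\<close>

lemma PiM_std_normal_eq_density:
  assumes I: "finite I"
  shows "iid_std_normal I
       = density (PiM I (\<lambda>_. lborel)) (\<lambda>x. \<Prod>i\<in>I. ennreal (std_normal_density (x i)))"
proof (rule sym, rule std_normals.PiM_eqI)
  interpret L: product_sigma_finite "\<lambda>_. lborel :: real measure" by standard
  show "finite I" by (rule I)
  show "sets (density (PiM I (\<lambda>_. lborel)) (\<lambda>x. \<Prod>i\<in>I. ennreal (std_normal_density (x i))))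
      = sets (iid_std_normal I)"
    by (simp cong: sets_PiM_cong)
  fix A :: "'a \<Rightarrow> real set"
  assume A: "\<And>i. i \<in> I \<Longrightarrow> A i \<in> sets std_normal_distribution"
  have box: "indicator (Pi\<^sub>E I A) x = (\<Prod>i\<in>I. indicator (A i) (x i) :: ennreal)"
    if "x \<in> space (PiM I (\<lambda>_. lborel :: real measure))" for x
    using that I by (auto simp: space_PiM PiE_iff indicator_def prod_zero_iff)
  have "Pi\<^sub>E I A \<in> sets (PiM I (\<lambda>_. lborel))"
    using A I by (intro sets_PiM_I_finite) auto
  then have "emeasure (density (PiM I (\<lambda>_. lborel)) (\<lambda>x. \<Prod>i\<in>I. ennreal (std_normal_density (x i)))) (Pi\<^sub>E I A)
      = (\<integral>\<^sup>+ x. (\<Prod>i\<in>I. ennreal (std_normal_density (x i))) * indicator (Pi\<^sub>E I A) x \<partial>PiM I (\<lambda>_. lborel))"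
    by (intro emeasure_density) auto
  also have "\<dots> = (\<integral>\<^sup>+ x. (\<Prod>i\<in>I. ennreal (std_normal_density (x i)) * indicator (A i) (x i)) \<partial>PiM I (\<lambda>_. lborel))"
    by (intro nn_integral_cong) (simp add: box prod.distrib)
  also have "\<dots> = (\<Prod>i\<in>I. \<integral>\<^sup>+ y. ennreal (std_normal_density y) * indicator (A i) y \<partial>lborel)"
    using A I by (intro L.product_nn_integral_prod) auto
  also have "\<dots> = (\<Prod>i\<in>I. emeasure std_normal_distribution (A i))"
    using A by (intro prod.cong) (auto simp: emeasure_density)
  finally show "emeasure (density (PiM I (\<lambda>_. lborel)) (\<lambda>x. \<Prod>i\<in>I. ennreal (std_normal_density (x i)))) (Pi\<^sub>E I A)
      = (\<Prod>i\<in>I. emeasure std_normal_distribution (A i))" .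
qed

lemma nn_integral_std_gaussian:
  fixes h :: "real ^ 'n::finite \<Rightarrow> ennreal"
  assumes [measurable]: "h \<in> borel_measurable borel"
  shows "(\<integral>\<^sup>+ x. h x \<partial>std_gaussian)
       = (\<integral>\<^sup>+ x. h (\<Sum>b\<in>Basis. x b *\<^sub>R b) \<partial>iid_std_normal Basis)"
proof -
  have "(\<integral>\<^sup>+ x. h x \<partial>std_gaussian)
      = (\<integral>\<^sup>+ x. (\<Prod>b\<in>Basis. ennreal (std_normal_density (x \<bullet> b))) * h x \<partial>lborel)"
    unfolding std_gaussian_def std_gaussian_density_eq_prod
    by (subst nn_integral_density) (simp_all add: prod_ennreal)
  also have "\<dots> = (\<integral>\<^sup>+ x. (\<Prod>b\<in>Basis. ennreal (std_normal_density (x b))) * h (\<Sum>b\<in>Basis. x b *\<^sub>R b)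
      \<partial>PiM Basis (\<lambda>_. lborel))"
    by (subst lborel_eq, subst nn_integral_distr) simp_all
  also have "\<dots> = (\<integral>\<^sup>+ x. h (\<Sum>b\<in>Basis. x b *\<^sub>R b) \<partial>iid_std_normal Basis)"
    by (subst PiM_std_normal_eq_density[OF finite_Basis], subst nn_integral_density) simp_all
  finally show ?thesis .
qed

section \<open>The small ball estimate\<close>

text \<open>Lebesgue measure is defined through coordinates indexed by the basis vectors, so the \<open>i\<close>-th
  variable of the polynomial is the coordinate with index \<open>axis i 1\<close>.\<close>
lemma rpoly_eval_in_basis_coordinates:
  fixes p :: "'n::finite rpoly"
  shows "poly_on (Basis :: (real ^ 'n) set) (rpoly_total_degree p)
           (\<lambda>x. rpoly_eval p (\<Sum>b\<in>Basis. x b *\<^sub>R b))"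
proof -
  have coord: "(\<Sum>b\<in>Basis. x b *\<^sub>R b) $ i = x (axis i 1)" for x :: "real ^ 'n \<Rightarrow> real" and i
    by (simp add: cart_eq_inner_axis inner_sum_left_Basis)
  have "poly_on (Basis :: (real ^ 'n) set) (rpoly_total_degree p)
      (\<lambda>x. Poly_Mapping.lookup p m * (\<Prod>i\<in>UNIV. x (axis i 1) ^ Poly_Mapping.lookup m i))"
    if "m \<in> Poly_Mapping.keys p" for m
  proof (rule poly_on_mono[OF poly_on_scale[OF poly_on_monomial]])
    show "(\<Sum>i\<in>UNIV. Poly_Mapping.lookup m i) \<le> rpoly_total_degree p"
      unfolding rpoly_total_degree_def using that by (intro Max_ge) auto
  qed auto
  then show ?thesis
    unfolding rpoly_eval_def coord by (intro poly_on_sum) auto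
qed

lemma rpoly_eval_zero_imp_zero:
  fixes p :: "'n::finite rpoly"
  assumes zero: "\<And>x. rpoly_eval p x = 0"
  shows "p = 0"
proof -
  have "Poly_Mapping.lookup p m = 0" if "m \<in> Poly_Mapping.keys p" for m
  proof (rule monomials_linearly_independent[where I = UNIV and S = "Poly_Mapping.keys p"
        and e = Poly_Mapping.lookup and c = "Poly_Mapping.lookup p"])
    show "(\<Sum>m\<in>Poly_Mapping.keys p. Poly_Mapping.lookup p m * (\<Prod>i\<in>UNIV. x i ^ Poly_Mapping.lookup m i)) = 0"
      for x using zero[of "\<chi> i. x i"] by (simp add: rpoly_eval_def)
  qed (use that in \<open>auto intro: poly_mapping_eqI\<close>)
  then show ?thesis by (metis in_keys_iff lookup_zero poly_mapping_eqI)
qed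

theorem theorem1p2:
  fixes f :: "real ^ 'n::finite \<Rightarrow> real" and p :: "'n rpoly" and \<epsilon> :: real
  assumes "f = rpoly_eval p"
    and "rpoly_total_degree p = 2"
    and "\<And>x. f x \<ge> 0"
    and "\<epsilon> > 0"
  shows "\<P>(x in std_gaussian. f x \<le> \<epsilon> * prob_space.expectation std_gaussian f)
           \<le> (2 * exp 1 * \<epsilon>) powr (1 / 2)"
proof -
  interpret G: prob_space "std_gaussian :: (real ^ 'n) measure" by (rule prob_space_std_gaussian)
  let ?N = "iid_std_normal (Basis :: (real ^ 'n) set)"
  let ?q = "\<lambda>x. f (\<Sum>b\<in>Basis. x b *\<^sub>R b)"
  have [measurable]: "f \<in> borel_measurable borel"
    unfolding assms(1) rpoly_eval_def by (intro borel_measurable_continuous_onI continuous_intros)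
  have q: "poly_on Basis 2 ?q"
    using rpoly_eval_in_basis_coordinates[of p] assms(1,2) by simp
  obtain m where m: "0 \<le> m" "(\<integral>\<^sup>+ x. ennreal (?q x) \<partial>?N) = ennreal m" "m = 0 \<longrightarrow> (\<forall>x. ?q x = 0)"
    by (rule nonneg_quadratic_mean[OF finite_Basis q assms(3)])
  have "(\<integral>\<^sup>+ x. ennreal (f x) \<partial>std_gaussian) = ennreal m"
    using m(2) by (subst nn_integral_std_gaussian) simp_all
  then have mean: "G.expectation f = m"
    using assms(3) m(1) by (subst integral_eq_nn_integral) auto
  have "m \<noteq> 0"
  proof
    assume "m = 0"
    then have "f x = 0" for x
      using m(3)[rule_format, of "\<lambda>b. x \<bullet> b"] by (simp add: euclidean_representation)
    then have "p = 0" using assms(1) by (intro rpoly_eval_zero_imp_zero) simp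
    then show False using assms(2) by (simp add: rpoly_total_degree_def)
  qed
  then have m_pos: "0 < m" using m(1) by simp
  (* Makes the exponential factor exp (t * eps * m) the constant exp (1/2) and 1 + 2 t m = 1 + 1/eps;
     the optimal t is smaller by 1 / (2 m), a gain of a factor that tends to 1 as eps tends to 0. *)
  define t where "t = 1 / (2 * \<epsilon> * m)"
  have t: "0 < t" "t * (\<epsilon> * m) = 1 / 2" "2 * t * m = 1 / \<epsilon>"
    using m_pos \<open>\<epsilon> > 0\<close> by (simp_all add: t_def)
  have "(\<integral>\<^sup>+ x. ennreal (exp (- t * f x)) \<partial>std_gaussian) = (\<integral>\<^sup>+ x. ennreal (exp (- t * ?q x)) \<partial>?N)"
    by (subst nn_integral_std_gaussian) simp_all
  also have "\<dots> \<le> ennreal (1 / sqrt (1 + 2 * t * m))"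
    using t(1) by (intro nonneg_quadratic_laplace_bound finite_Basis q assms(3) m) simp
  finally have laplace: "(\<integral>\<^sup>+ x. ennreal (exp (- t * f x)) \<partial>std_gaussian) \<le> ennreal (1 / sqrt (1 + 1 / \<epsilon>))"
    by (simp add: t(3))
  have "emeasure std_gaussian {x. f x \<le> \<epsilon> * m}
      = (\<integral>\<^sup>+ x. indicator {x. f x \<le> \<epsilon> * m} x \<partial>std_gaussian)"
    by (rule nn_integral_indicator[symmetric]) measurable
  also have "\<dots> \<le> (\<integral>\<^sup>+ x. ennreal (exp (1 / 2)) * ennreal (exp (- t * f x)) \<partial>std_gaussian)"
  proof (rule nn_integral_mono)
    fix x
    show "indicator {x. f x \<le> \<epsilon> * m} x \<le> ennreal (exp (1 / 2)) * ennreal (exp (- t * f x))"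
    proof (cases "f x \<le> \<epsilon> * m")
      case True
      then have "t * f x \<le> 1 / 2" using t(1) mult_left_mono[of "f x" "\<epsilon> * m" t] unfolding t(2) by simp
      then show ?thesis using True
        by (simp add: ennreal_mult[symmetric] exp_add[symmetric] del: ennreal_1 add: ennreal_1[symmetric])
    qed simp
  qed
  also have "\<dots> = ennreal (exp (1 / 2)) * (\<integral>\<^sup>+ x. ennreal (exp (- t * f x)) \<partial>std_gaussian)"
    by (rule nn_integral_cmult) measurable
  also have "\<dots> \<le> ennreal (exp (1 / 2)) * ennreal (1 / sqrt (1 + 1 / \<epsilon>))"
    using laplace by (rule mult_left_mono) simp
  also have "\<dots> = ennreal (exp (1 / 2) / sqrt (1 + 1 / \<epsilon>))"
    using \<open>\<epsilon> > 0\<close> by (subst ennreal_mult[symmetric]) simp_all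
  finally have "G.prob {x. f x \<le> \<epsilon> * m} \<le> exp (1 / 2) / sqrt (1 + 1 / \<epsilon>)"
    using \<open>\<epsilon> > 0\<close> by (simp add: G.emeasure_eq_measure)
  also have "\<dots> \<le> exp (1 / 2) / sqrt (1 / \<epsilon>)"
    using \<open>\<epsilon> > 0\<close> by (intro divide_left_mono) (auto intro!: mult_pos_pos add_pos_pos)
  also have "\<dots> = sqrt (exp 1 * \<epsilon>)"
  proof -
    have "exp (1 / 2 :: real) = sqrt (exp 1)"
      by (rule real_sqrt_unique[symmetric]) (simp_all add: power2_eq_square exp_add[symmetric])
    then show ?thesis using \<open>\<epsilon> > 0\<close> by (simp add: real_sqrt_mult real_sqrt_divide)
  qed
  also have "\<dots> \<le> sqrt (2 * exp 1 * \<epsilon>)"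
    using \<open>\<epsilon> > 0\<close> by simp
  also have "\<dots> = (2 * exp 1 * \<epsilon>) powr (1 / 2)"
    using \<open>\<epsilon> > 0\<close> by (simp add: powr_half_sqrt)
  finally show ?thesis by (simp add: mean)
qed

end
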